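(* Let $\Gamma$ be a simple connected graph with $\operatorname{diam}(\Gamma)\geq 4$, and let $A(\Gamma)$ be its adjacency matrix. Then there exists a non-zero $(0,1)$-vector in the row space of $A(\Gamma)$ over $\mathbb{R}$ which does not occur as a row of $A(\Gamma)$.
   Context: For a simple graph with vertices $v_1,\dots,v_n$, the adjacency matrix $A(\Gamma)=(a_{ij})$ has $a_{ij}=1$ if $v_i$ is adjacent to $v_j$ and $a_{ij}=0$ otherwise. The row space is taken over the real numbers. $\operatorname{diam}(\Gamma)$ is the maximum distance between two vertices. *)

theory Defs
  imports
    "Graph_Theory.Shortest_Path"
    "Graph_Theory.Digraph_Component"
    "Jordan_Normal_Form.VS_Connect"
begin

text \<open>
  A simple graph is the library's \<^term>\<open>graph\<close>: a finite loop-free digraph without parallel arcs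
  whose arc relation is symmetric, so that an undirected edge is a pair of opposite arcs.
\<close>

text \<open>The distance is the library's shortest-path cost for unit arc weights.\<close>
definition (in wf_digraph) distance :: "'a \<Rightarrow> 'a \<Rightarrow> ereal" where
  "distance u v = \<mu> (\<lambda>_. 1) u v"

definition (in wf_digraph) diameter :: ereal where
  "diameter = Max {distance u v | u v. u \<in> verts G \<and> v \<in> verts G}"

text \<open>The list \<^term>\<open>vs\<close> fixes the numbering of the vertices; indices start at 0.\<close>
definition adjacency_matrix :: "('a, 'b) pre_digraph \<Rightarrow> 'a list \<Rightarrow> real mat" where
  "adjacency_matrix G vs =
     mat (length vs) (length vs) (\<lambda>(i, j). if vs ! i \<rightarrow>\<^bsub>G\<^esub> vs ! j then 1 else 0)"

lemma (in wf_digraph) distance_eq_INF_length: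
  "distance u v = (INF p \<in> {p. awalk u p v}. ereal (real (length p)))"
proof -
  have "awalk_cost (\<lambda>_. 1) p = real (length p)" for p :: "'b list"
    by (induction p) auto
  then show ?thesis by (simp add: distance_def \<mu>_def)
qed

end

theory Submission
  imports Defs
begin

text \<open>
  Take vertices \<open>u\<close>, \<open>v\<close> at distance at least 4, and let \<open>b\<close> be a neighbour of \<open>v\<close>, so that the
  distance from \<open>u\<close> to \<open>b\<close> is at least 3. Then \<open>u\<close> and \<open>b\<close> have no common neighbour, and the sum of
  their rows is a non-zero \<open>(0,1)\<close>-vector. If it were the row of a vertex \<open>z\<close>, then \<open>z\<close> would be
  adjacent both to a neighbour of \<open>u\<close> and to \<open>v\<close>, which gives a walk of length 3 from \<open>u\<close> to \<open>v\<close>.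
  (Adding the rows of \<open>u\<close> and \<open>v\<close> themselves works only for distance at least 5.)
\<close>

lemma (in wf_digraph) distance_le_3:
  assumes "u \<rightarrow> a" "a \<rightarrow> b" "b \<rightarrow> v"
  shows "distance u v \<le> 3"
proof -
  obtain e f g where "arc e (u, a)" "arc f (a, b)" "arc g (b, v)"
    using assms by (auto simp: arcs_ends_conv arc_def)
  then have "awalk u [e, f, g] v"
    by (auto simp: awalk_simps arc_def)
  from min_cost_le_walk_cost[OF this, of "\<lambda>_. 1"] show ?thesis
    by (simp add: distance_def)
qed

lemma (in wf_digraph) distance_self_le:
  assumes "v \<in> verts G"
  shows "distance v v \<le> 0"
  using min_cost_le_walk_cost[of v "[]" v "\<lambda>_. 1"] assms
  by (simp add: distance_def awalk_Nil_iff zero_ereal_def)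

text \<open>\<open>Max\<close> of a set is known to be a member only if the set is finite and
  non-empty; here the set is an image of the finite \<open>verts G \<times> verts G\<close>.\<close>

lemma (in fin_digraph) diameter_attained:
  assumes "verts G \<noteq> {}"
  obtains u v where "u \<in> verts G" "v \<in> verts G" "distance u v = diameter"
proof -
  let ?D = "{distance u v | u v. u \<in> verts G \<and> v \<in> verts G}"
  have "?D = (\<lambda>(u, v). distance u v) ` (verts G \<times> verts G)" by auto
  then have "finite ?D" by simp
  moreover have "?D \<noteq> {}" using assms by blast
  ultimately have "diameter \<in> ?D" unfolding diameter_def by (rule Max_in)
  then show thesis using that by force
qed

text \<open>\<open>connected\<close> speaks of reachability in the symmetric closure, which agrees
  with reachability in \<open>G\<close> when the arcs are symmetric; a path between distinct
  vertices has a first arc.\<close>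

lemma (in sym_digraph) connected_imp_adj:
  assumes "Digraph_Component.connected G" "u \<in> verts G" "v \<in> verts G" "u \<noteq> v"
  obtains a where "u \<rightarrow> a"
proof -
  have "u \<rightarrow>\<^sup>* v"
    using assms reachable_mk_symmetric_eq[OF sym_arcs]
    by (auto simp: connected_def strongly_connected_def)
  then show thesis
    using that assms(4) by (cases rule: converse_reachable_cases) auto
qed

lemma (in vec_space) row_add_row_in_row_space:
  assumes "A \<in> carrier_mat m n" "i < m" "j < m"
  shows "row A i + row A j \<in> row_space A"
proof -
  have sub: "set (rows A) \<subseteq> carrier V" using assms(1) rows_carrier[of A] by auto
  moreover have "row A i \<in> set (rows A)" "row A j \<in> set (rows A)"
    using assms by (auto simp: rows_def)
  ultimately show ?thesis
    unfolding row_space_def using span_add1 span_mem by auto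
qed

lemma adjacency_matrix_carrier:
  "adjacency_matrix G vs \<in> carrier_mat (length vs) (length vs)"
  by (simp add: adjacency_matrix_def)

lemma row_adjacency_matrix:
  assumes "i < length vs" "k < length vs"
  shows "row (adjacency_matrix G vs) i $ k = (if vs ! i \<rightarrow>\<^bsub>G\<^esub> vs ! k then 1 else 0)"
  using assms by (simp add: adjacency_matrix_def)

theorem theorem3p1:
  fixes G :: "('a, 'b) pre_digraph" and vs :: "'a list"
  assumes "graph G"
    and "Digraph_Component.connected G"
    and "wf_digraph.diameter G \<ge> 4"
    and "distinct vs" and "set vs = verts G"
  shows "\<exists>x \<in> vec_space.row_space (length vs) (adjacency_matrix G vs).
    x \<noteq> 0\<^sub>v (length vs) \<and>
    (\<forall>i < length vs. x $ i \<in> {0, 1}) \<and>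
    x \<notin> set (rows (adjacency_matrix G vs))"
proof -
  interpret graph G by fact
  let ?A = "adjacency_matrix G vs"
  have "verts G \<noteq> {}"
    using assms(2) by (auto simp: connected_def strongly_connected_def)
  then obtain u v where uv: "u \<in> verts G" "v \<in> verts G" and d: "distance u v \<ge> 4"
    using diameter_attained assms(3) by metis
  have no_walk: False if "u \<rightarrow>\<^bsub>G\<^esub> a" "a \<rightarrow>\<^bsub>G\<^esub> b" "b \<rightarrow>\<^bsub>G\<^esub> v" for a b
    using order_trans[OF d distance_le_3[OF that]] by simp
  have "u \<noteq> v"
    using order_trans[OF d] distance_self_le[OF uv(1)] by fastforce
  obtain a where ua: "u \<rightarrow>\<^bsub>G\<^esub> a"
    using connected_imp_adj[OF assms(2) uv \<open>u \<noteq> v\<close>] by blast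
  obtain b where vb: "v \<rightarrow>\<^bsub>G\<^esub> b"
    using connected_imp_adj[OF assms(2) uv(2,1)] \<open>u \<noteq> v\<close> by blast
  have bv: "b \<rightarrow>\<^bsub>G\<^esub> v" using vb graph_symmetric by blast
  \<comment> \<open>A common neighbour \<open>w\<close> would give the walk \<open>u\<close>,
    \<open>w\<close>, \<open>b\<close>, \<open>v\<close>.\<close>
  have disj: "\<not> (u \<rightarrow>\<^bsub>G\<^esub> w \<and> b \<rightarrow>\<^bsub>G\<^esub> w)" for w
    using no_walk[of w b] bv graph_symmetric by blast
  have "a \<in> verts G" "b \<in> verts G" using ua bv by (auto dest: adj_in_verts)
  then obtain iu iv ia ib where idx:
    "iu < length vs" "vs ! iu = u" "iv < length vs" "vs ! iv = v"
    "ia < length vs" "vs ! ia = a" "ib < length vs" "vs ! ib = b"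
    using uv assms(5) by (metis in_set_conv_nth)
  define x where "x = row ?A iu + row ?A ib"
  \<comment> \<open>By \<open>disj\<close> no entry is 1 + 1, so the sum acts as a
    disjunction.\<close>
  have x_nth: "x $ k = (if u \<rightarrow>\<^bsub>G\<^esub> vs ! k \<or> b \<rightarrow>\<^bsub>G\<^esub> vs ! k then 1 else 0)" if "k < length vs" for k
    using that idx disj[of "vs ! k"] row_adjacency_matrix[OF _ that, of _ G]
    by (auto simp: x_def adjacency_matrix_def)
  have "x \<in> vec_space.row_space (length vs) ?A"
    unfolding x_def
    using vec_space.row_add_row_in_row_space[OF adjacency_matrix_carrier] idx by blast
  \<comment> \<open>The entry at \<open>v\<close> is 1, since \<open>b\<close> is adjacent to
    \<open>v\<close>.\<close>
  moreover have "x \<noteq> 0\<^sub>v (length vs)"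
    using x_nth[of iv] idx bv by auto
  moreover have "\<forall>i < length vs. x $ i \<in> {0, 1}"
    using x_nth by simp
  moreover have "x \<notin> set (rows ?A)"
  proof
    assume "x \<in> set (rows ?A)"
    then obtain z where z: "z < length vs" "x = row ?A z"
      by (auto simp: rows_def adjacency_matrix_def)
    have adj: "vs ! z \<rightarrow>\<^bsub>G\<^esub> vs ! k" if "k < length vs" "u \<rightarrow>\<^bsub>G\<^esub> vs ! k \<or> b \<rightarrow>\<^bsub>G\<^esub> vs ! k" for k
      using x_nth[OF that(1)] row_adjacency_matrix[OF z(1) that(1), of G] that(2) z(2)
      by (simp split: if_splits)
    \<comment> \<open>Column \<open>ia\<close> is 1 because of \<open>u\<close>, column
      \<open>iv\<close> because of \<open>b\<close>; the forbidden walk is then \<open>u\<close>,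
      \<open>a\<close>, \<open>vs ! z\<close>, \<open>v\<close>.\<close>
    have "vs ! z \<rightarrow>\<^bsub>G\<^esub> a" "vs ! z \<rightarrow>\<^bsub>G\<^esub> v"
      using adj[of ia] adj[of iv] idx ua bv by auto
    then show False using no_walk[OF ua] graph_symmetric by blast
  qed
  ultimately show ?thesis by blast
qed

end
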